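(* Let $a$ and $t$ be odd integers and let $c \geq 0$ be an integer. Suppose there exists a positive integer $b$ with $t \not\equiv \pm 1 \pmod{2^b}$, and let $b$ be the smallest such positive integer. Define the sequence $\mathbf{s} = (s(n))_{n \geq 0}$ by $$s(n) = a\,\frac{(t^2)^{n+c} - 1}{2^b}.$$ Then for all integers $n \geq 1$, the discriminator of $\mathbf{s}$ satisfies $D_{\mathbf{s}}(n) = 2^{\lceil \log_2 n \rceil}$.
   Context: A positive integer $m$ discriminates a set $S$ of integers if the elements of $S$ are pairwise incongruent modulo $m$. For a sequence $\mathbf{s} = (s(i))_{i \geq 0}$ of distinct integers and an integer $n \geq 1$, the discriminator $D_{\mathbf{s}}(n)$ is the least positive integer $m$ that discriminates the set $\{s(0), s(1), \ldots, s(n-1)\}$. *)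

theory Defs
  imports Complex_Main "HOL-Number_Theory.Cong"
begin

definition discriminates :: "nat \<Rightarrow> int set \<Rightarrow> bool" where
  "discriminates m S \<longleftrightarrow> pairwise (\<lambda>x y. \<not> [x = y] (mod int m)) S"

(* Meaningful for injective s: then some positive m discriminates the finite
   set of the first n values, so the least such m exists. *)
definition discriminator :: "(nat \<Rightarrow> int) \<Rightarrow> nat \<Rightarrow> nat" where
  "discriminator s n = (LEAST m. m > 0 \<and> discriminates m (s ` {..<n}))"

(* For b the least positive exponent with t not congruent to 1 or -1 modulo 2^b,
   the following shows that 2^b divides (t^2)^k - 1 (so that integer division by 2^b
   is exact) and that n \<mapsto> a * (((t^2)^(n+c) - 1) div 2^b) is injective. *)
lemma two_power_dvd:
  fixes t :: int and b k :: nat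
  assumes "odd t" and "b > 0"
    and least: "\<And>b'. \<lbrakk>0 < b'; b' < b\<rbrakk> \<Longrightarrow> [t = 1] (mod 2 ^ b') \<or> [t = - 1] (mod 2 ^ b')"
  shows "2 ^ b dvd (t\<^sup>2) ^ k - 1"
proof -
  have ev: "2 dvd t - 1" "2 dvd t + 1" using \<open>odd t\<close> by auto
  have eq: "t\<^sup>2 - 1 = (t - 1) * (t + 1)" by (simp add: power2_eq_square algebra_simps)
  have "2 ^ b dvd t\<^sup>2 - 1"
  proof (cases "b = 1")
    case True
    then show ?thesis using \<open>odd t\<close> by simp
  next
    case False
    then obtain d where d: "b = Suc d" "d > 0" using \<open>b > 0\<close> by (cases b) auto
    then have "2 ^ d dvd t - 1 \<or> 2 ^ d dvd t + 1"
      using least[of d] by (auto simp: cong_iff_dvd_diff)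
    then have "2 ^ d * 2 dvd (t - 1) * (t + 1)"
      using ev mult_dvd_mono[of "2 ^ d" "t - 1" 2 "t + 1"]
        mult_dvd_mono[of "2 ^ d" "t + 1" 2 "t - 1"] by (auto simp: mult.commute)
    then show ?thesis using d eq by (simp add: mult.commute)
  qed
  moreover have "t\<^sup>2 - 1 dvd (t\<^sup>2) ^ k - 1"
    using power_diff_1_eq[of "t\<^sup>2" k] by simp
  ultimately show ?thesis by (rule dvd_trans)
qed

lemma seq_inj:
  fixes a t :: int and b c :: nat
  assumes "odd a" and "odd t" and "b > 0"
    and "\<not> [t = 1] (mod 2 ^ b)" and "\<not> [t = - 1] (mod 2 ^ b)"
    and least: "\<And>b'. \<lbrakk>0 < b'; b' < b\<rbrakk> \<Longrightarrow> [t = 1] (mod 2 ^ b') \<or> [t = - 1] (mod 2 ^ b')"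
  shows "inj (\<lambda>n. a * (((t\<^sup>2) ^ (n + c) - 1) div 2 ^ b))"
proof (rule injI)
  fix m n
  assume "a * (((t\<^sup>2) ^ (m + c) - 1) div 2 ^ b) = a * (((t\<^sup>2) ^ (n + c) - 1) div 2 ^ b)"
  moreover have "a \<noteq> 0" using \<open>odd a\<close> by auto
  ultimately have "((t\<^sup>2) ^ (m + c) - 1) div 2 ^ b = ((t\<^sup>2) ^ (n + c) - 1) div 2 ^ b"
    by simp
  then have "(t\<^sup>2) ^ (m + c) - 1 = (t\<^sup>2) ^ (n + c) - 1"
    using two_power_dvd[OF \<open>odd t\<close> \<open>b > 0\<close> least] dvd_div_eq_iff by blast
  then have eq: "(t\<^sup>2) ^ (m + c) = (t\<^sup>2) ^ (n + c)" by simp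
  have "t \<noteq> 1" "t \<noteq> - 1" "t \<noteq> 0" using assms by auto
  then have "t\<^sup>2 \<noteq> 1" "t\<^sup>2 > 0" by (auto simp: power2_eq_1_iff)
  then have "t\<^sup>2 > 1" by linarith
  then show "m = n" using eq power_inject_exp by fastforce
qed

end

theory Submission
  imports Defs
begin

text \<open>Since \<open>2 ^ b\<close> exactly divides \<open>u - 1\<close> for \<open>u = t\<^sup>2\<close>, the 2-adic valuation of
  \<open>(u ^ k - 1) / 2 ^ b\<close> is that of \<open>k\<close>, so \<open>2 ^ e\<close> discriminates the first \<open>n\<close> terms if
  and only if \<open>n \<le> 2 ^ e\<close>. Conversely let \<open>m = 2 ^ f * (2 * h + 1) < 2 ^ e\<close> and \<open>2 ^ (e - 1) < n\<close>.
  Up to sign there are only \<open>h + 1\<close> residues modulo \<open>2 * h + 1\<close>, so among \<open>t ^ 0, \<dots>, t ^ h\<close>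
  two agree up to sign or one is \<open>0\<close>; in both cases the squares
  collide early enough to give two terms congruent modulo \<open>m\<close> below index \<open>n\<close>.\<close>

text \<open>Lifting the exponent at 2. Since 4 divides u - 1, u + 1 is twice an odd number, so
  squaring \<open>u\<close> raises the exact exponent \<open>b\<close> by one, which accounts for
  one factor 2 of an even \<open>k\<close>. For odd \<open>k\<close> the cofactor of u - 1 in u^k -
  1 is a sum of \<open>k\<close> odd terms, hence odd, and no factor 2 is gained.\<close>

lemma two_power_dvd_power_diff_1_iff:
  fixes u :: int
  assumes "4 dvd u - 1" "2 ^ b dvd u - 1" "\<not> 2 ^ Suc b dvd u - 1"
  shows "2 ^ (b + f) dvd u ^ k - 1 \<longleftrightarrow> 2 ^ f dvd k"
  using assms
proof (induction f arbitrary: u b k)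
  case 0
  have "u - 1 dvd u ^ k - 1" by (simp add: power_diff_1_eq)
  then show ?case using "0.prems" by (auto intro: dvd_trans)
next
  case (Suc f)
  have "odd u" using Suc.prems(1) by presburger
  show ?case
  proof (cases "even k")
    case True
    then obtain l where k: "k = 2 * l" by blast
    have eq: "u\<^sup>2 - 1 = (u - 1) * (u + 1)" by (simp add: power2_eq_square algebra_simps)
    obtain w where w: "u + 1 = 2 * w" "odd w"
    proof
      show "u + 1 = 2 * ((u + 1) div 2)" "odd ((u + 1) div 2)"
        using Suc.prems(1) by presburger+
    qed
    have "4 dvd u\<^sup>2 - 1" "2 ^ Suc b dvd u\<^sup>2 - 1"
      using Suc.prems by (auto simp: eq w)
    moreover have "\<not> 2 ^ Suc (Suc b) dvd u\<^sup>2 - 1"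
    proof
      assume "2 ^ Suc (Suc b) dvd u\<^sup>2 - 1"
      then have "2 * 2 ^ Suc b dvd 2 * ((u - 1) * w)" by (simp add: eq w mult.left_commute)
      then have "2 ^ Suc b dvd (u - 1) * w" by (subst (asm) dvd_mult_cancel_left) simp
      moreover have "coprime (2 ^ Suc b) w" using w by simp
      ultimately show False using Suc.prems(3) coprime_dvd_mult_left_iff by blast
    qed
    ultimately have "2 ^ (Suc b + f) dvd (u\<^sup>2) ^ l - 1 \<longleftrightarrow> 2 ^ f dvd l"
      by (rule Suc.IH)
    then show ?thesis by (simp add: k power_mult)
  next
    case False
    have "\<not> 2 ^ (b + Suc f) dvd u ^ k - 1"
    proof
      assume "2 ^ (b + Suc f) dvd u ^ k - 1"
      then have "2 ^ Suc b dvd u ^ k - 1"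
        by (rule dvd_trans[rotated]) (simp add: le_imp_power_dvd del: power_Suc)
      then have "2 ^ Suc b dvd (u - 1) * (\<Sum>i<k. u ^ i)" by (simp only: power_diff_1_eq)
      moreover have "odd (\<Sum>i<k. u ^ i)" using False \<open>odd u\<close>
        by (simp add: even_sum_iff)
      then have "coprime (2 ^ Suc b) (\<Sum>i<k. u ^ i)" by simp
      ultimately show False using Suc.prems(3) coprime_dvd_mult_left_iff by blast
    qed
    then show ?thesis using False by auto
  qed
qed

text \<open>Supplies the hypotheses of the previous lemma for u = t^2. Exactly one of t - 1 and t +
  1 is twice an odd number, so if 2^(b+1) divided their product, 2^b would divide the other one,
  against the choice of \<open>b\<close>.\<close>

lemma least_not_pm1_exact_dvd:
  fixes t :: int
  assumes "odd t" "b > 0" "\<not> [t = 1] (mod 2 ^ b)" "\<not> [t = - 1] (mod 2 ^ b)"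
    and least: "\<And>b'. \<lbrakk>0 < b'; b' < b\<rbrakk> \<Longrightarrow> [t = 1] (mod 2 ^ b') \<or> [t = - 1] (mod 2 ^ b')"
  shows "4 dvd t\<^sup>2 - 1" "2 ^ b dvd t\<^sup>2 - 1" "\<not> 2 ^ Suc b dvd t\<^sup>2 - 1"
proof -
  have eq: "t\<^sup>2 - 1 = (t - 1) * (t + 1)" by (simp add: power2_eq_square algebra_simps)
  have ev: "even (t - 1)" "even (t + 1)" using \<open>odd t\<close> by auto
  show "4 dvd t\<^sup>2 - 1" using mult_dvd_mono[OF ev] by (simp add: eq)
  show "2 ^ b dvd t\<^sup>2 - 1" using two_power_dvd[OF assms(1,2) least, of 1] by simp
  have n: "\<not> 2 ^ b dvd t - 1" "\<not> 2 ^ b dvd t + 1"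
    using assms(3,4) by (auto simp: cong_iff_dvd_diff)
  show "\<not> 2 ^ Suc b dvd t\<^sup>2 - 1"
  proof
    assume "2 ^ Suc b dvd t\<^sup>2 - 1"
    then have d: "2 * 2 ^ b dvd (t - 1) * (t + 1)" by (simp add: eq)
    obtain x where x: "t - 1 = 2 * x" using ev by blast
    have y: "t + 1 = 2 * (x + 1)" using x by simp
    have "2 * 2 ^ b dvd 2 * ((t - 1) * (x + 1))" "2 * 2 ^ b dvd 2 * (x * (t + 1))"
      using d by (simp_all only: x y mult_ac)
    then have d': "2 ^ b dvd (t - 1) * (x + 1)" "2 ^ b dvd x * (t + 1)"
      by (subst (asm) (1 2) dvd_mult_cancel_left; simp)+
    show False
    proof (cases "even x")
      case True
      then have "coprime (2 ^ b) (x + 1)" by simp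
      then show False using d' n coprime_dvd_mult_left_iff by blast
    next
      case False
      then have "coprime (2 ^ b) x" by simp
      then show False using d' n coprime_dvd_mult_right_iff by blast
    qed
  qed
qed

lemma square_powers_collide:
  fixes t :: int and h :: nat
  defines "m \<equiv> 2 * int h + 1"
  shows "(\<exists>i\<le>h. m dvd t ^ i) \<or> (\<exists>i j. i < j \<and> j \<le> h \<and> m dvd (t\<^sup>2) ^ i * ((t\<^sup>2) ^ (j - i) - 1))"
proof -
  have "m > 0" by (simp add: m_def)
  \<comment> \<open>The distance from t^i to the nearest multiple of \<open>m\<close>: it is t^i up
    to sign modulo \<open>m\<close> and can take only the h + 1 values 0, ..., h.\<close>
  define g where "g i = (if t ^ i mod m \<le> int h then t ^ i mod m else m - t ^ i mod m)" for i
  have g: "m dvd t ^ i - g i \<or> m dvd t ^ i + g i" for i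
  proof (cases "t ^ i mod m \<le> int h")
    case True
    then show ?thesis by (simp add: g_def)
  next
    case False
    have "t ^ i + g i = m + (t ^ i - t ^ i mod m)" using False by (simp add: g_def)
    then show ?thesis by (metis dvd_add dvd_minus_mod dvd_refl)
  qed
  have range: "g ` {..h} \<subseteq> {0..int h}"
  proof (rule image_subsetI)
    fix i
    have "0 \<le> t ^ i mod m" "t ^ i mod m < m" using \<open>m > 0\<close> by auto
    then show "g i \<in> {0..int h}" by (auto simp: g_def m_def)
  qed
  have sq: "m dvd (t\<^sup>2) ^ i - (g i)\<^sup>2" for i
  proof -
    have "(t\<^sup>2) ^ i = (t ^ i)\<^sup>2" by (simp only: power_mult[symmetric] mult.commute)
    then have "(t\<^sup>2) ^ i - (g i)\<^sup>2 = (t ^ i - g i) * (t ^ i + g i)"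
      by (simp add: power2_eq_square algebra_simps)
    then show ?thesis using g[of i] by auto
  qed
  show ?thesis
  proof (cases "inj_on g {..h}")
    case True
    \<comment> \<open>Distinct values at h + 1 indices fill a range of h + 1 elements, so 0 is
      attained.\<close>
    have "g ` {..h} = {0..int h}"
      by (rule card_subset_eq[OF _ range]) (simp_all add: card_image[OF True])
    then obtain i where "i \<le> h" "g i = 0" by (metis (no_types, lifting) atLeastAtMost_iff atMost_iff
          imageE of_nat_0_le_iff order_refl)
    then show ?thesis using g[of i] by auto
  next
    case False
    then obtain i j where ij: "i < j" "j \<le> h" "g i = g j"
      by (auto simp: inj_on_def) (metis linorder_neqE_nat)
    have "m dvd (t\<^sup>2) ^ j - (t\<^sup>2) ^ i"
      using dvd_diff[OF sq[of j] sq[of i]] ij by simp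
    also have "(t\<^sup>2) ^ j - (t\<^sup>2) ^ i = (t\<^sup>2) ^ i * ((t\<^sup>2) ^ (j - i) - 1)"
      using ij by (simp add: right_diff_distrib flip: power_add)
    finally show ?thesis using ij by blast
  qed
qed

text \<open>\<open>i\<close> and \<open>i + k\<close> will index two congruent terms. Divisibility
  of \<open>k\<close> by 2^f serves the 2-part of \<open>m\<close>, the last condition serves its
  odd part, and \<open>i + k \<le> 2 ^ e\<close> keeps both indices below any n > 2^e.\<close>

lemma early_collision:
  fixes t :: int and m e :: nat
  assumes "m > 0" "m < 2 ^ Suc e"
  obtains f h i k where "m = 2 ^ f * (2 * h + 1)" "k > 0" "2 ^ f dvd k" "i + k \<le> 2 ^ e"
    "2 * int h + 1 dvd (t\<^sup>2) ^ i * ((t\<^sup>2) ^ k - 1)"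
proof -
  obtain f m' where m': "m = 2 ^ f * m'" "odd m'"
    using multiplicity_decompose'[of m 2] \<open>m > 0\<close> by (metis gr_implies_not0 odd_one)
  then obtain h where m: "m = 2 ^ f * (2 * h + 1)" by (auto elim: oddE)
  show thesis
  proof (cases "h = 0")
    case True
    then have "(2::nat) ^ f < 2 ^ Suc e" using assms m by simp
    then have "f \<le> e" by (subst (asm) power_strict_increasing_iff) simp_all
    then show thesis using True m by (intro that[of f h "2 ^ f" 0]) auto
  next
    case False
    define F :: nat where "F = 2 ^ f"
    have F: "F \<ge> 1" by (simp add: F_def)
    have mF: "m = 2 * (F * h) + F" by (simp add: m F_def algebra_simps)
    have N: "m < 2 * 2 ^ e" using assms by simp
    from square_powers_collide[of h t] show thesis
    proof (elim disjE exE conjE)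
      fix i assume i: "i \<le> h" "2 * int h + 1 dvd t ^ i"
      \<comment> \<open>The odd part already divides t^(2i), which leaves \<open>k\<close> free: the
        smallest positive multiple of 2^f, namely \<open>F\<close>, is chosen.\<close>
      have "t ^ i dvd (t\<^sup>2) ^ i" by (simp add: power2_eq_square power_mult_distrib)
      then have "2 * int h + 1 dvd (t\<^sup>2) ^ i" using i(2) dvd_trans by blast
      moreover
      \<comment> \<open>\<open>(F - 1) * (h - 1) \<ge> 0\<close>, with truncation avoided by substitution\<close>
      have "h + F \<le> F * h + 1"
      proof -
        obtain F' h' where "F = Suc F'" "h = Suc h'"
          using F False by (metis One_nat_def Suc_le_D not0_implies_Suc)
        then show ?thesis by simp
      qed
      \<comment> \<open>From 2Fh < 2^(e+1) follows Fh + 1 \<le> 2^e, so strictness absorbs the extra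
        1.\<close>
      then have "i + F \<le> 2 ^ e" using i(1) mF N F by linarith
      ultimately show thesis using m by (intro that[of f h F i]) (auto simp: F_def)
    next
      fix i j assume ij: "i < j" "j \<le> h"
        "2 * int h + 1 dvd (t\<^sup>2) ^ i * ((t\<^sup>2) ^ (j - i) - 1)"
      \<comment> \<open>Stretching the gap j - i by the factor \<open>F\<close> makes it a multiple
        of 2^f and preserves divisibility by the odd part; the larger index is still at most
        Fh.\<close>
      have "(t\<^sup>2) ^ (j - i) - 1 dvd (t\<^sup>2) ^ (F * (j - i)) - 1"
        using power_diff_1_eq[of "(t\<^sup>2) ^ (j - i)" F]
        by (simp add: mult.commute[of F] power_mult)
      then have "2 * int h + 1 dvd (t\<^sup>2) ^ i * ((t\<^sup>2) ^ (F * (j - i)) - 1)"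
        using ij(3) by (meson dvd_trans dvd_refl mult_dvd_mono)
      moreover have "i + F * (j - i) \<le> F * i + F * (j - i)" using F by simp
      then have "i + F * (j - i) \<le> F * j" using ij by (simp add: diff_mult_distrib2)
      then have "i + F * (j - i) \<le> F * h" using ij by (meson mult_le_mono2 le_trans)
      then have "i + F * (j - i) \<le> 2 ^ e" using mF N by linarith
      ultimately show thesis using m ij F
        by (intro that[of f h "F * (j - i)" i]) (auto simp: F_def)
    qed
  qed
qed

text \<open>The second bound is stated for \<open>e = Suc d\<close>, so it claims nothing for n = 1,
  where e = 0.\<close>

lemma nat_ceiling_log2_bounds:
  fixes n :: nat
  assumes "n \<ge> 1"
  defines "e \<equiv> nat \<lceil>log 2 (real n)\<rceil>"
  shows "n \<le> 2 ^ e" "e = Suc d \<Longrightarrow> 2 ^ d < n"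
proof -
  have nn: "log 2 (real n) \<ge> 0" using assms by simp
  then have "log 2 (real n) \<le> real e" unfolding e_def by linarith
  then have "real n \<le> 2 powr real e" using \<open>n \<ge> 1\<close> by (subst (asm) log_le_iff) simp_all
  also have "\<dots> = real (2 ^ e)" by (subst powr_realpow) simp_all
  finally show "n \<le> 2 ^ e" by (simp only: of_nat_le_iff)
  assume "e = Suc d"
  then have "log 2 (real n) > real d" unfolding e_def by linarith
  then have "2 powr real d < real n" using \<open>n \<ge> 1\<close> by (subst (asm) less_log_iff) simp_all
  moreover have "2 powr real d = real (2 ^ d)" by (subst powr_realpow) simp_all
  ultimately show "2 ^ d < n" by (simp only: of_nat_less_iff)
qed

theorem theorem8:
  fixes a t :: int and b c :: nat and s :: "nat \<Rightarrow> int"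
  assumes "odd a" and "odd t"
    and "\<exists>b::nat. b > 0 \<and> \<not> [t = 1] (mod 2 ^ b) \<and> \<not> [t = - 1] (mod 2 ^ b)"
    and "b = (LEAST b. b > 0 \<and> \<not> [t = 1] (mod 2 ^ b) \<and> \<not> [t = - 1] (mod 2 ^ b))"
    and "\<And>n. s n = a * (((t\<^sup>2) ^ (n + c) - 1) div 2 ^ b)"
  shows "\<forall>n\<ge>1. discriminator s n = 2 ^ nat \<lceil>log 2 (real n)\<rceil>"
proof (intro allI impI)
  fix n :: nat assume n: "n \<ge> 1"
  have b: "b > 0" "\<not> [t = 1] (mod 2 ^ b)" "\<not> [t = - 1] (mod 2 ^ b)"
    using LeastI_ex[OF assms(3)] by (simp_all add: assms(4)[symmetric])
  have least: "[t = 1] (mod 2 ^ b') \<or> [t = - 1] (mod 2 ^ b')" if "0 < b'" "b' < b" for b'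
    using not_less_Least[of b'] that unfolding assms(4) by blast
  note exact = least_not_pm1_exact_dvd[OF \<open>odd t\<close> b least]
  have inj: "inj s"
    using seq_inj[OF \<open>odd a\<close> \<open>odd t\<close> b least] assms(5) by (simp add: inj_def)
  define q where "q k = ((t\<^sup>2) ^ k - 1) div 2 ^ b" for k
  have q: "(t\<^sup>2) ^ k - 1 = 2 ^ b * q k" for k
    using two_power_dvd[OF \<open>odd t\<close> b(1) least] by (simp add: q_def)
  \<comment> \<open>Cancelling 2^b in the lifting lemma: \<open>q k\<close> and \<open>k\<close>
    have the same powers of 2 as divisors.\<close>
  have qdvd: "2 ^ f dvd q k \<longleftrightarrow> 2 ^ f dvd k" for f k
    using two_power_dvd_power_diff_1_iff[OF exact, of f k] by (simp add: q power_add)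
  \<comment> \<open>All factors besides \<open>q k\<close> are odd, so congruence of two terms
    modulo a power of 2 depends only on the gap \<open>k\<close> of their indices.\<close>
  have diff: "s (i + k) - s i = a * (t\<^sup>2) ^ c * ((t\<^sup>2) ^ i * q k)" for i k
  proof -
    have "2 ^ b * (s (i + k) - s i) = a * (2 ^ b * q (i + k + c) - 2 ^ b * q (i + c))"
      by (simp add: assms(5) q_def algebra_simps)
    also have "\<dots> = a * (t\<^sup>2) ^ c * (t\<^sup>2) ^ i * ((t\<^sup>2) ^ k - 1)"
      unfolding q[symmetric] by (simp add: power_add algebra_simps)
    also have "\<dots> = 2 ^ b * (a * (t\<^sup>2) ^ c * ((t\<^sup>2) ^ i * q k))"
      by (simp add: q)
    finally show ?thesis by simp
  qed
  define e where "e = nat \<lceil>log 2 (real n)\<rceil>"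
  have "discriminates (2 ^ e) (s ` {..<n})"
  proof -
    \<comment> \<open>Two of the first \<open>n\<close> indices differ by less than n \<le> 2^e, so
      2^e cannot divide their gap.\<close>
    have *: "\<not> [s (i + k) = s i] (mod 2 ^ e)" if "k > 0" "i + k < n" for i k
    proof
      assume "[s (i + k) = s i] (mod 2 ^ e)"
      then have "2 ^ e dvd (a * (t\<^sup>2) ^ c * (t\<^sup>2) ^ i) * q k"
        by (simp add: cong_iff_dvd_diff diff mult.assoc)
      moreover have "coprime (2 ^ e) (a * (t\<^sup>2) ^ c * (t\<^sup>2) ^ i)"
        using \<open>odd a\<close> \<open>odd t\<close> by simp
      ultimately have "2 ^ e dvd q k" using coprime_dvd_mult_right_iff by blast
      then have "2 ^ e \<le> k" using qdvd that dvd_imp_le by blast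
      then show False using nat_ceiling_log2_bounds(1)[OF n] that by (simp add: e_def)
    qed
    have "\<not> [s i = s j] (mod 2 ^ e)" if "i < n" "j < n" "s i \<noteq> s j" for i j
    proof (cases i j rule: linorder_cases)
      case less
      then show ?thesis using *[of "j - i" i] that by (auto simp: cong_sym_eq)
    next
      case greater
      then show ?thesis using *[of "i - j" j] that by auto
    qed (use that in simp)
    then show ?thesis by (auto simp: discriminates_def pairwise_def)
  qed
  moreover have "2 ^ e \<le> m" if m: "m > 0" "discriminates m (s ` {..<n})" for m
  proof (rule ccontr)
    assume "\<not> 2 ^ e \<le> m"
    then have "m < 2 ^ e" by simp
    \<comment> \<open>If e = 0, then m < 1, against m > 0.\<close>
    with m(1) obtain d where d: "e = Suc d" by (cases e) auto
    then have dn: "2 ^ d < n" using nat_ceiling_log2_bounds(2)[OF n] by (simp add: e_def)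
    obtain f h i k where fh: "m = 2 ^ f * (2 * h + 1)" and k: "k > 0" "2 ^ f dvd k"
      "i + k \<le> 2 ^ d" and dv: "2 * int h + 1 dvd (t\<^sup>2) ^ i * ((t\<^sup>2) ^ k - 1)"
      by (rule early_collision[OF m(1) \<open>m < 2 ^ e\<close>[unfolded d]])
    \<comment> \<open>The odd part of \<open>m\<close> is coprime to 2^b, so its divisibility
      survives the division by 2^b in \<open>q\<close>.\<close>
    have "2 * int h + 1 dvd 2 ^ b * ((t\<^sup>2) ^ i * q k)"
      using dv by (simp add: q mult.left_commute)
    moreover have "coprime (2 * int h + 1) (2 ^ b)" by simp
    ultimately have "2 * int h + 1 dvd (t\<^sup>2) ^ i * q k"
      using coprime_dvd_mult_right_iff by blast
    moreover have "2 ^ f dvd (t\<^sup>2) ^ i * q k" using qdvd k by simp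
    moreover have "coprime (2 ^ f) (2 * int h + 1)" by simp
    ultimately have "2 ^ f * (2 * int h + 1) dvd (t\<^sup>2) ^ i * q k"
      by (blast intro: divides_mult)
    then have "int m dvd (t\<^sup>2) ^ i * q k" by (simp add: fh algebra_simps)
    then have "[s (i + k) = s i] (mod int m)" by (simp add: cong_iff_dvd_diff diff)
    \<comment> \<open>\<open>discriminates\<close> compares only distinct elements of a set, so the
      congruence contradicts it only once the two terms are known to differ.\<close>
    moreover have "s (i + k) \<noteq> s i" using inj k by (auto dest: injD)
    ultimately show False using m(2) k dn by (auto simp: discriminates_def pairwise_def)
  qed
  ultimately show "discriminator s n = 2 ^ nat \<lceil>log 2 (real n)\<rceil>"
    unfolding discriminator_def e_def[symmetric] by (intro Least_equality) auto
qed

end
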